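(* Let $m$ be an arbitrary element of an $\mathbb{O}$-bimodule $M$. Then $\mathbb{O}m=m\mathbb{O}$ if and only if $m$ is cyclic, i.e. $\langle m\rangle_{\mathbb{O}}=\mathbb{O}m$.
   Context: $\mathbb{O}$ is the real division algebra of octonions. A left $\mathbb{O}$-module is a real vector space $M$ with an $\mathbb{R}$-bilinear map $\mathbb{O}\times M\to M$, $(p,m)\mapsto pm$, such that $1m=m$ and $[p,q,m]=-[q,p,m]$ for all $p,q\in\mathbb{O}$, $m\in M$, where $[p,q,m]:=(pq)m-p(qm)$. An $\mathbb{O}$-bimodule is a left $\mathbb{O}$-module $M$ with in addition an $\mathbb{R}$-bilinear right multiplication $M\times\mathbb{O}\to M$, $(m,p)\mapsto mp$, with $m1=m$, such that $[p,q,m]=[m,p,q]=[q,m,p]$ for all $p,q\in\mathbb{O}$, $m\in M$, where $[m,p,q]:=(mp)q-m(pq)$ and $[q,m,p]:=(qm)p-q(mp)$. Here $\mathbb{O}m=\{pm\mid p\in\mathbb{O}\}$, $m\mathbb{O}=\{mp\mid p\in\mathbb{O}\}$, and $\langle m\rangle_{\mathbb{O}}$ is the (left) $\mathbb{O}$-submodule generated by $m$. *)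

theory Defs
  imports "HOL-Analysis.Analysis"
begin

section \<open>The octonions\<close>

text \<open>
  The octonions are obtained by the Cayley--Dickson construction in the convention
  \<open>(a, b) (c, d) = (a c - d\<^sup>* b, d a + b c\<^sup>*)\<close>, \<open>(a, b)\<^sup>* = (a\<^sup>*, - b)\<close>.
  It is applied to \<open>\<complex>\<close> to give the quaternions (a pair \<open>(z, w)\<close> stands for \<open>z + w j\<close>), and then
  to the quaternions. Addition and real scaling of pairs are componentwise.
\<close>

type_synonym quat = "complex \<times> complex"

definition quat_cnj :: "quat \<Rightarrow> quat" where
  "quat_cnj x = (cnj (fst x), - snd x)"

definition quat_mult :: "quat \<Rightarrow> quat \<Rightarrow> quat" where
  "quat_mult x y =
     (fst x * fst y - cnj (snd y) * snd x, snd y * fst x + snd x * cnj (fst y))"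

datatype octonion = Octonion (quat1: quat) (quat2: quat)

instantiation octonion :: real_vector
begin

definition "0 = Octonion 0 0"
definition "x + y = Octonion (quat1 x + quat1 y) (quat2 x + quat2 y)"
definition "x - y = Octonion (quat1 x - quat1 y) (quat2 x - quat2 y)"
definition "- x = Octonion (- quat1 x) (- quat2 x)"
definition "r *\<^sub>R x = Octonion (r *\<^sub>R quat1 x) (r *\<^sub>R quat2 x)"

instance
  by standard
    (simp_all add: zero_octonion_def plus_octonion_def minus_octonion_def uminus_octonion_def
      scaleR_octonion_def algebra_simps)

end

instantiation octonion :: "{one, times}"
begin

definition "1 = Octonion (1, 0) 0"
definition "x * y = Octonion
   (quat_mult (quat1 x) (quat1 y) - quat_mult (quat_cnj (quat2 y)) (quat2 x))
   (quat_mult (quat2 y) (quat1 x) + quat_mult (quat2 x) (quat_cnj (quat1 y)))"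

instance ..

end

definition octonion_cnj :: "octonion \<Rightarrow> octonion" where
  "octonion_cnj x = Octonion (quat_cnj (quat1 x)) (- quat2 x)"

definition octonion_norm_sq :: "octonion \<Rightarrow> real" where
  "octonion_norm_sq x = (norm (quat1 x))\<^sup>2 + (norm (quat2 x))\<^sup>2"

lemmas octonion_defs =
  zero_octonion_def plus_octonion_def minus_octonion_def uminus_octonion_def scaleR_octonion_def
  one_octonion_def times_octonion_def octonion_cnj_def quat_mult_def quat_cnj_def

lemma octonion_eq_iff:
  "x = y \<longleftrightarrow>
     Re (fst (quat1 x)) = Re (fst (quat1 y)) \<and> Im (fst (quat1 x)) = Im (fst (quat1 y)) \<and>
     Re (snd (quat1 x)) = Re (snd (quat1 y)) \<and> Im (snd (quat1 x)) = Im (snd (quat1 y)) \<and>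
     Re (fst (quat2 x)) = Re (fst (quat2 y)) \<and> Im (fst (quat2 x)) = Im (fst (quat2 y)) \<and>
     Re (snd (quat2 x)) = Re (snd (quat2 y)) \<and> Im (snd (quat2 x)) = Im (snd (quat2 y))"
  by (auto simp: octonion.expand prod_eq_iff complex_eq_iff intro!: octonion.expand)

lemma octonion_norm_sq_coords:
  "octonion_norm_sq x =
     (Re (fst (quat1 x)))\<^sup>2 + (Im (fst (quat1 x)))\<^sup>2 + (Re (snd (quat1 x)))\<^sup>2 + (Im (snd (quat1 x)))\<^sup>2 +
     (Re (fst (quat2 x)))\<^sup>2 + (Im (fst (quat2 x)))\<^sup>2 + (Re (snd (quat2 x)))\<^sup>2 + (Im (snd (quat2 x)))\<^sup>2"
  by (simp add: octonion_norm_sq_def norm_prod_def cmod_power2)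

lemma octonion_mult_one [simp]:
  fixes x :: octonion
  shows "1 * x = x" "x * 1 = x"
  by (simp_all add: octonion_eq_iff octonion_defs)

lemma bilinear_octonion_mult: "bilinear ((*) :: octonion \<Rightarrow> octonion \<Rightarrow> octonion)"
  unfolding bilinear_def
  by (auto intro!: linearI simp: octonion_eq_iff octonion_defs algebra_simps)

lemma octonion_norm_sq_mult:
  "octonion_norm_sq (x * y) = octonion_norm_sq x * octonion_norm_sq y"
  by (simp add: octonion_norm_sq_coords octonion_defs power2_eq_square algebra_simps)

lemma octonion_norm_sq_eq_0_iff: "octonion_norm_sq x = 0 \<longleftrightarrow> x = 0"
proof
  assume "octonion_norm_sq x = 0"
  then have "quat1 x = 0 \<and> quat2 x = 0"
    by (simp add: octonion_norm_sq_def add_nonneg_eq_0_iff)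
  then show "x = 0"
    by (simp add: zero_octonion_def octonion.expand)
qed (simp add: octonion_norm_sq_def zero_octonion_def)

lemma octonion_cnj_mult_cancel:
  "octonion_cnj x * (x * y) = octonion_norm_sq x *\<^sub>R y"
  "x * (octonion_cnj x * y) = octonion_norm_sq x *\<^sub>R y"
  "(y * x) * octonion_cnj x = octonion_norm_sq x *\<^sub>R y"
  "(y * octonion_cnj x) * x = octonion_norm_sq x *\<^sub>R y"
  by (simp_all add: octonion_eq_iff octonion_norm_sq_coords octonion_defs power2_eq_square
      algebra_simps)

theorem octonion_division_algebra:
  fixes a b :: octonion
  assumes "a \<noteq> 0"
  shows "\<exists>!x. a * x = b" "\<exists>!x. x * a = b"
proof -
  let ?N = "octonion_norm_sq a"
  have N: "?N \<noteq> 0"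
    using assms by (simp add: octonion_norm_sq_eq_0_iff)
  have scale: "a * (r *\<^sub>R x) = r *\<^sub>R (a * x)" "(r *\<^sub>R x) * a = r *\<^sub>R (x * a)" for r x
    by (simp_all add: bilinear_lmul[OF bilinear_octonion_mult] bilinear_rmul[OF bilinear_octonion_mult])
  show "\<exists>!x. a * x = b"
  proof
    show "a * ((1 / ?N) *\<^sub>R (octonion_cnj a * b)) = b"
      using N by (simp add: scale octonion_cnj_mult_cancel)
    show "x = (1 / ?N) *\<^sub>R (octonion_cnj a * b)" if "a * x = b" for x
      using N octonion_cnj_mult_cancel(1)[of a x] that by simp
  qed
  show "\<exists>!x. x * a = b"
  proof
    show "((1 / ?N) *\<^sub>R (b * octonion_cnj a)) * a = b"
      using N by (simp add: scale octonion_cnj_mult_cancel)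
    show "x = (1 / ?N) *\<^sub>R (b * octonion_cnj a)" if "x * a = b" for x
      using N octonion_cnj_mult_cancel(3)[of x a] that by simp
  qed
qed


section \<open>Left modules and bimodules\<close>

text \<open>
  The scalar action of a module is written prefix: \<open>lm p m\<close> is \<open>p m\<close>, and \<open>rm m p\<close> is \<open>m p\<close>.
\<close>

locale left_octonion_module =
  fixes lm :: "octonion \<Rightarrow> 'm::real_vector \<Rightarrow> 'm"
  assumes bilinear_left: "bilinear lm"
    and left_one: "lm 1 m = m"
    and left_alternating:
      "lm (p * q) m - lm p (lm q m) = - (lm (q * p) m - lm q (lm p m))"

locale octonion_bimodule = left_octonion_module lm
  for lm :: "octonion \<Rightarrow> 'm::real_vector \<Rightarrow> 'm" +
  fixes rm :: "'m \<Rightarrow> octonion \<Rightarrow> 'm"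
  assumes bilinear_right: "bilinear rm"
    and right_one: "rm m 1 = m"
    and associator_left_right:
      "lm (p * q) m - lm p (lm q m) = rm (rm m p) q - rm m (p * q)"
    and associator_right_middle:
      "rm (rm m p) q - rm m (p * q) = rm (lm q m) p - lm q (rm m p)"

lemma octonion_bimodule_regular: "octonion_bimodule (*) (*)"
  by unfold_locales
    (simp_all add: bilinear_octonion_mult,
     simp_all add: octonion_eq_iff octonion_defs algebra_simps)

definition left_octonion_submodule ::
  "(octonion \<Rightarrow> 'm::real_vector \<Rightarrow> 'm) \<Rightarrow> 'm set \<Rightarrow> bool" where
  "left_octonion_submodule lm N \<longleftrightarrow> subspace N \<and> (\<forall>p. \<forall>n\<in>N. lm p n \<in> N)"

definition generated_left_submodule ::
  "(octonion \<Rightarrow> 'm::real_vector \<Rightarrow> 'm) \<Rightarrow> 'm \<Rightarrow> 'm set" where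
  "generated_left_submodule lm m = left_octonion_submodule lm hull {m}"

definition left_orbit :: "(octonion \<Rightarrow> 'm \<Rightarrow> 'm) \<Rightarrow> 'm \<Rightarrow> 'm set" where
  "left_orbit lm m = {lm p m | p. True}"

definition right_orbit :: "('m \<Rightarrow> octonion \<Rightarrow> 'm) \<Rightarrow> 'm \<Rightarrow> 'm set" where
  "right_orbit rm m = {rm m p | p. True}"

definition cyclic_element :: "(octonion \<Rightarrow> 'm::real_vector \<Rightarrow> 'm) \<Rightarrow> 'm \<Rightarrow> bool" where
  "cyclic_element lm m \<longleftrightarrow> generated_left_submodule lm m = left_orbit lm m"

end

theory Submission
  imports Defs
begin

text \<open>
  Every bimodule is \<open>O Z\<close>, where \<open>Z\<close> consists of the elements that commute and associate with all
  octonions, and both properties of \<open>m\<close> say that \<open>m = x z\<close> for some \<open>x \<in> O\<close> and \<open>z \<in> Z\<close>.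
  The projection onto \<open>Z\<close> is a product of three commuting idempotents in the left multiplications,
  and a linear functional \<open>f\<close> on \<open>M\<close> induces the bimodule homomorphism \<open>x z \<mapsto> f(z) x\<close> into \<open>O\<close>.
  Applying two such homomorphisms to \<open>m\<close> gives octonions \<open>v, w\<close> such that for every \<open>p\<close> a single \<open>q\<close>
  satisfies \<open>p v = v q\<close> and \<open>p w = w q\<close> (respectively, for all \<open>p, q\<close> a single \<open>r\<close> satisfies
  \<open>p (q v) = r v\<close> and \<open>p (q w) = r w\<close>). Either condition forces \<open>v, w\<close> to be linearly dependent, so
  all the images of \<open>m\<close> lie on one line \<open>\<real> x\<close>.
\<close>

section \<open>Units of the octonions\<close>

definition e1 :: octonion where "e1 = Octonion (\<i>, 0) 0"
definition e2 :: octonion where "e2 = Octonion (0, 1) 0"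
definition e3 :: octonion where "e3 = Octonion (0, \<i>) 0"
definition e4 :: octonion where "e4 = Octonion 0 (1, 0)"
definition e5 :: octonion where "e5 = Octonion 0 (\<i>, 0)"
definition e6 :: octonion where "e6 = Octonion 0 (0, 1)"
definition e7 :: octonion where "e7 = Octonion 0 (0, \<i>)"

lemmas unit_defs = e1_def e2_def e3_def e4_def e5_def e6_def e7_def

definition octonion_re :: "octonion \<Rightarrow> real" where
  "octonion_re x = Re (fst (quat1 x))"

lemma unit_square:
  "e1 * e1 = - 1"
  "e2 * e2 = - 1"
  "e3 * e3 = - 1"
  "e4 * e4 = - 1"
  "e5 * e5 = - 1"
  "e6 * e6 = - 1"
  "e7 * e7 = - 1"
  by (simp_all add: unit_defs octonion_eq_iff octonion_defs)

lemma unit_anticommute: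
  "e2 * e1 = - (e1 * e2)"
  "e3 * e1 = - (e1 * e3)"
  "e4 * e1 = - (e1 * e4)"
  "e5 * e1 = - (e1 * e5)"
  "e6 * e1 = - (e1 * e6)"
  "e7 * e1 = - (e1 * e7)"
  "e3 * e2 = - (e2 * e3)"
  "e4 * e2 = - (e2 * e4)"
  "e5 * e2 = - (e2 * e5)"
  "e6 * e2 = - (e2 * e6)"
  "e7 * e2 = - (e2 * e7)"
  "e4 * e3 = - (e3 * e4)"
  "e5 * e3 = - (e3 * e5)"
  "e6 * e3 = - (e3 * e6)"
  "e7 * e3 = - (e3 * e7)"
  "e5 * e4 = - (e4 * e5)"
  "e6 * e4 = - (e4 * e6)"
  "e7 * e4 = - (e4 * e7)"
  "e6 * e5 = - (e5 * e6)"
  "e7 * e5 = - (e5 * e7)"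
  "e7 * e6 = - (e6 * e7)"
  by (simp_all add: unit_defs octonion_eq_iff octonion_defs)

lemma octonion_mult_minus [simp]:
  fixes p q :: octonion
  shows "(- p) * q = - (p * q)" "p * (- q) = - (p * q)"
  by (simp_all add: octonion_eq_iff octonion_defs)

text \<open>Distinct units have imaginary products and \<open>e * e = - 1\<close>, so the coordinate
  of \<open>x\<close> at \<open>e\<close> is \<open>- octonion_re (e * x)\<close>. Left
  multiplications alone thus recover coordinates, which \<open>re_expand\<close> and
  \<open>hom\<close> imitate in a module.\<close>

lemma octonion_expand:
  "x = octonion_re x *\<^sub>R 1
     - octonion_re (e1 * x) *\<^sub>R e1 - octonion_re (e2 * x) *\<^sub>R e2 - octonion_re (e3 * x) *\<^sub>R e3
     - octonion_re (e4 * x) *\<^sub>R e4 - octonion_re (e5 * x) *\<^sub>R e5 - octonion_re (e6 * x) *\<^sub>R e6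
     - octonion_re (e7 * x) *\<^sub>R e7"
  by (simp add: octonion_re_def unit_defs octonion_eq_iff octonion_defs)

lemma octonion_subspace_UNIV:
  assumes "subspace S" "1 \<in> S" "e1 \<in> S" "e2 \<in> S" "e3 \<in> S" "e4 \<in> S" "e5 \<in> S" "e6 \<in> S" "e7 \<in> S"
  shows "x \<in> S"
  by (subst octonion_expand[of x]) (intro subspace_diff subspace_scale assms)

text \<open>The imaginary units of a quaternion subalgebra; all nine products are listed so that the
  unfolded definition serves as a set of rewrite rules.\<close>

definition quaternion_triple :: "octonion \<Rightarrow> octonion \<Rightarrow> octonion \<Rightarrow> bool" where
  "quaternion_triple p q n \<longleftrightarrow>
     p * p = - 1 \<and> q * q = - 1 \<and> n * n = - 1 \<and> p * q = n \<and> q * n = p \<and> n * p = q \<and>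
     q * p = - n \<and> n * q = - p \<and> p * n = - q"

lemma quaternion_triple_cyclic: "quaternion_triple p q n \<Longrightarrow> quaternion_triple q n p"
  by (auto simp: quaternion_triple_def)

lemma unit_triples:
  "quaternion_triple e1 e2 e3" "quaternion_triple e1 e4 e5" "quaternion_triple e2 e4 e6"
  by (simp_all add: quaternion_triple_def unit_defs octonion_eq_iff octonion_defs)

lemma unit_products: "e1 * e2 = e3" "e1 * e4 = e5" "e2 * e4 = e6" "e3 * e4 = e7"
  by (simp_all add: unit_defs octonion_eq_iff octonion_defs)

section \<open>Pairs of octonions\<close>

lemma octonion_real_if_commutes:
  fixes v :: octonion
  assumes "\<And>p. p * v = v * p"
  shows "v = octonion_re v *\<^sub>R 1"
  using assms[of e1] assms[of e2] assms[of e4]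
  by (simp add: octonion_re_def unit_defs octonion_eq_iff octonion_defs)

text \<open>Each of the three associators used vanishes only on the quaternion subalgebra of its two
  units, and these subalgebras meet in the reals.\<close>

lemma octonion_real_if_nuclear:
  fixes v :: octonion
  assumes "\<And>p q. p * (q * v) = (p * q) * v"
  shows "v = octonion_re v *\<^sub>R 1"
  using assms[of e1 e2] assms[of e1 e4] assms[of e2 e4]
  by (simp add: octonion_re_def unit_defs octonion_eq_iff octonion_defs)

text \<open>If the imaginary parts of \<open>v\<close> and \<open>w\<close> were independent, they
  would generate a quaternion subalgebra, and a nonzero \<open>p\<close> orthogonal to it would not
  associate with them.\<close>

lemma octonion_commutes_if_associates:
  fixes v w :: octonion
  assumes "\<And>p. p * (octonion_cnj v * w) = (p * octonion_cnj v) * w"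
  shows "v * w = w * v"
  using assms[of e1] assms[of e2] assms[of e3] assms[of e4] assms[of e5] assms[of e6] assms[of e7]
  by (simp add: unit_defs octonion_eq_iff octonion_defs algebra_simps)

lemma octonion_commuting_pair:
  fixes v w :: octonion
  assumes "v * w = w * v" "v \<noteq> octonion_re v *\<^sub>R 1"
  obtains a c where "w = a *\<^sub>R 1 + c *\<^sub>R v"
proof -
  define V where "V = v - octonion_re v *\<^sub>R 1"
  define W where "W = w - octonion_re w *\<^sub>R 1"
  have N: "octonion_norm_sq V \<noteq> 0"
    using assms(2) by (simp add: V_def octonion_norm_sq_eq_0_iff)
  \<comment> \<open>The imaginary part of a product of imaginary octonions is half their commutator,
    which vanishes here.\<close>
  obtain s where s: "V * W = s *\<^sub>R 1"
  proof
    show "V * W = octonion_re (V * W) *\<^sub>R 1"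
      using assms(1)
      by (simp add: V_def W_def octonion_re_def octonion_eq_iff octonion_defs algebra_simps)
  qed
  have "octonion_cnj V = - V"
    by (simp add: V_def octonion_re_def octonion_eq_iff octonion_defs)
  then have "octonion_norm_sq V *\<^sub>R W = - (s *\<^sub>R V)"
    using octonion_cnj_mult_cancel(1)[of V W]
    by (simp add: s bilinear_rmul[OF bilinear_octonion_mult])
  then have "octonion_norm_sq V *\<^sub>R W = octonion_norm_sq V *\<^sub>R ((- s / octonion_norm_sq V) *\<^sub>R V)"
    using N by simp
  then have "W = (- s / octonion_norm_sq V) *\<^sub>R V"
    using N by (simp only: scaleR_cancel_left) simp
  then obtain c where "W = c *\<^sub>R V" by blast
  then have "w = (octonion_re w - c * octonion_re v) *\<^sub>R 1 + c *\<^sub>R v"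
    by (simp add: V_def W_def algebra_simps)
  then show thesis by (rule that)
qed

lemma octonion_cancel_right:
  fixes v :: octonion
  assumes "p * v = q * v" "v \<noteq> 0"
  shows "p = q"
  using octonion_division_algebra(2)[OF assms(2), of "q * v"] assms(1) by blast

lemma octonion_cancel_left:
  fixes v :: octonion
  assumes "v * p = v * q" "v \<noteq> 0"
  shows "p = q"
  using octonion_division_algebra(1)[OF assms(2), of "v * q"] assms(1) by blast

lemmas octonion_bilinear =
  bilinear_ladd[OF bilinear_octonion_mult] bilinear_radd[OF bilinear_octonion_mult]
  bilinear_lmul[OF bilinear_octonion_mult] bilinear_rmul[OF bilinear_octonion_mult]

lemma octonion_multiple_if_real:
  assumes "v \<noteq> 0" "v = octonion_re v *\<^sub>R 1" "w = octonion_re w *\<^sub>R 1"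
  shows "\<exists>c. w = c *\<^sub>R v"
proof
  have "octonion_re v \<noteq> 0"
    using assms(1,2) by auto
  then have "(octonion_re w / octonion_re v) *\<^sub>R octonion_re v *\<^sub>R (1 :: octonion)
      = octonion_re w *\<^sub>R 1"
    by simp
  then show "w = (octonion_re w / octonion_re v) *\<^sub>R v"
    using assms(2,3) by metis
qed

text \<open>Cancelling \<open>v\<close> determines \<open>q\<close> for suitable \<open>p\<close>:
  always \<open>q = p\<close> if \<open>v\<close> is real, and otherwise
  \<open>q = octonion_cnj v\<close> for \<open>p = octonion_cnj v\<close>. The same \<open>q\<close>
  must then serve \<open>w\<close>.\<close>

lemma octonion_multiple_if_orbits_agree:
  fixes v w :: octonion
  assumes vw: "\<And>p. \<exists>q. p * v = v * q \<and> p * w = w * q" and v: "v \<noteq> 0"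
  shows "\<exists>c. w = c *\<^sub>R v"
proof (cases "v = octonion_re v *\<^sub>R 1")
  case True
  have "p * w = w * p" for p
  proof -
    obtain q where q: "p * v = v * q" "p * w = w * q"
      using vw by blast
    have "v * p = p * v"
      by (subst (1 2) True) (simp add: octonion_bilinear)
    then have "p = q"
      using octonion_cancel_left[of v p q] q(1) v by simp
    then show ?thesis
      using q(2) by simp
  qed
  then show ?thesis
    using octonion_multiple_if_real[OF v True] octonion_real_if_commutes by blast
next
  case False
  obtain q where q: "octonion_cnj v * v = v * q" "octonion_cnj v * w = w * q"
    using vw by blast
  have "octonion_cnj v * v = v * octonion_cnj v"
    using octonion_cnj_mult_cancel(1,2)[of v 1] by simp
  then have "q = octonion_cnj v"
    using octonion_cancel_left[of v q] q(1) v by simp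
  then have "octonion_cnj v * w = w * octonion_cnj v"
    using q(2) by simp
  moreover have "octonion_cnj v = (2 * octonion_re v) *\<^sub>R 1 - v"
    by (simp add: octonion_re_def octonion_eq_iff octonion_defs)
  ultimately have "v * w = w * v"
    by (simp add: octonion_eq_iff octonion_defs algebra_simps)
  then obtain a c where w: "w = a *\<^sub>R 1 + c *\<^sub>R v"
    using octonion_commuting_pair False by blast
  \<comment> \<open>Subtracting \<open>c\<close> times the condition on \<open>v\<close> from that
    on \<open>w\<close> leaves \<open>a *\<^sub>R p = a *\<^sub>R q\<close>.\<close>
  have "a = 0"
  proof (rule ccontr)
    assume a: "a \<noteq> 0"
    have "p * v = v * p" for p
    proof -
      obtain q where q: "p * v = v * q" "p * w = w * q"
        using vw by blast
      then have "p = q"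
        using a by (simp add: w octonion_bilinear)
      then show ?thesis
        using q(1) by simp
    qed
    then show False
      using octonion_real_if_commutes False by blast
  qed
  then show ?thesis
    using w by auto
qed

lemma octonion_multiple_if_orbit_closed:
  fixes v w :: octonion
  assumes vw: "\<And>p q. \<exists>r. p * (q * v) = r * v \<and> p * (q * w) = r * w" and v: "v \<noteq> 0"
  shows "\<exists>c. w = c *\<^sub>R v"
proof (cases "v = octonion_re v *\<^sub>R 1")
  case True
  have "p * (q * w) = (p * q) * w" for p q
  proof -
    obtain r where r: "p * (q * v) = r * v" "p * (q * w) = r * w"
      using vw by blast
    have "p * (q * v) = (p * q) * v"
      by (subst (1 2) True) (simp add: octonion_bilinear)
    then have "r = p * q"
      using octonion_cancel_right[of r v "p * q"] r(1) v by simp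
    then show ?thesis
      using r(2) by simp
  qed
  then show ?thesis
    using octonion_multiple_if_real[OF v True] octonion_real_if_nuclear by blast
next
  case False
  \<comment> \<open>The choice \<open>q = octonion_cnj v\<close> makes \<open>q * v\<close> real,
    which forces \<open>r = p * octonion_cnj v\<close>.\<close>
  have "p * (octonion_cnj v * w) = (p * octonion_cnj v) * w" for p
  proof -
    obtain r where r: "p * (octonion_cnj v * v) = r * v" "p * (octonion_cnj v * w) = r * w"
      using vw by blast
    have "p * (octonion_cnj v * v) = (p * octonion_cnj v) * v"
      using octonion_cnj_mult_cancel(1)[of v 1] octonion_cnj_mult_cancel(4)[of p v]
      by (simp add: octonion_bilinear)
    then have "r = p * octonion_cnj v"
      using octonion_cancel_right[of r v "p * octonion_cnj v"] r(1) v by simp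
    then show ?thesis
      using r(2) by simp
  qed
  then obtain a c where w: "w = a *\<^sub>R 1 + c *\<^sub>R v"
    using octonion_commutes_if_associates octonion_commuting_pair False by blast
  have "a = 0"
  proof (rule ccontr)
    assume a: "a \<noteq> 0"
    have "p * (q * v) = (p * q) * v" for p q
    proof -
      obtain r where r: "p * (q * v) = r * v" "p * (q * w) = r * w"
        using vw by blast
      then have "p * q = r"
        using a by (simp add: w octonion_bilinear)
      then show ?thesis
        using r(1) by simp
    qed
    then show False
      using octonion_real_if_nuclear False by blast
  qed
  then show ?thesis
    using w by auto
qed

section \<open>The center of a bimodule\<close>

lemma eq_uminus_self:
  fixes x :: "'a::real_vector"
  assumes "x = - x"
  shows "x = 0"
proof -
  have "2 *\<^sub>R x = x + x"
    by (rule scaleR_2)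
  also have "\<dots> = 0"
    using assms by (metis add.right_inverse)
  finally show ?thesis
    by simp
qed

context octonion_bimodule
begin

lemmas left_simps =
  bilinear_ladd[OF bilinear_left] bilinear_radd[OF bilinear_left]
  bilinear_lmul[OF bilinear_left] bilinear_rmul[OF bilinear_left]
  bilinear_lneg[OF bilinear_left] bilinear_rneg[OF bilinear_left]
  bilinear_lzero[OF bilinear_left] bilinear_rzero[OF bilinear_left]
  bilinear_lsub[OF bilinear_left] bilinear_rsub[OF bilinear_left]

lemmas right_simps =
  bilinear_ladd[OF bilinear_right] bilinear_radd[OF bilinear_right]
  bilinear_lmul[OF bilinear_right] bilinear_rmul[OF bilinear_right]
  bilinear_lneg[OF bilinear_right] bilinear_rneg[OF bilinear_right]
  bilinear_lzero[OF bilinear_right] bilinear_rzero[OF bilinear_right]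
  bilinear_lsub[OF bilinear_right] bilinear_rsub[OF bilinear_right]

section \<open>Associators and the Clifford relations\<close>

definition assoc :: "octonion \<Rightarrow> octonion \<Rightarrow> 'm \<Rightarrow> 'm" where
  "assoc p q m = lm (p * q) m - lm p (lm q m)"

lemma assoc_swap: "assoc q p m = - assoc p q m"
  using left_alternating[of q p m] by (simp add: assoc_def)

lemma assoc_self [simp]: "assoc p p m = 0"
  using assoc_swap[of p p m] by (rule eq_uminus_self)

lemma assoc_right: "assoc p q m = rm (rm m p) q - rm m (p * q)"
  by (simp add: assoc_def associator_left_right)

lemma assoc_middle: "assoc p q m = rm (lm q m) p - lm q (rm m p)"
  by (simp add: assoc_def associator_left_right associator_right_middle)

lemma linear_assoc: "linear (\<lambda>q. assoc p q m)"
  by (rule linearI) (simp_all add: assoc_def left_simps octonion_bilinear algebra_simps)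

lemma left_square: "lm p (lm p m) = lm (p * p) m"
  using assoc_self[of p m] by (simp add: assoc_def del: assoc_self)

lemma left_square_minus_one: "p * p = - 1 \<Longrightarrow> lm p (lm p m) = - m"
  by (simp add: left_square left_simps left_one)

text \<open>Alternativity polarizes to
  \<open>lm q (lm p m) + lm p (lm q m) = lm (q * p + p * q) m\<close>.\<close>

lemma left_anticommute: "q * p = - (p * q) \<Longrightarrow> lm q (lm p m) = - lm p (lm q m)"
  using assoc_swap[of q p m] by (simp add: assoc_def left_simps) (metis minus_minus)

lemma right_anticommute: "q * p = - (p * q) \<Longrightarrow> rm (rm m q) p = - rm (rm m p) q"
  using assoc_swap[of q p m] by (simp add: assoc_right right_simps)

lemma left_right_commute: "lm p (rm m p) = rm (lm p m) p"
  using assoc_middle[of p p m] by simp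

section \<open>Right multiplication in terms of a quaternion triple\<close>

lemma assoc_anticommute:
  assumes "quaternion_triple p q n"
  shows "rm (assoc p q m) p = - lm p (assoc p q m)"
proof -
  note [simp] = assms[unfolded quaternion_triple_def]
  have n: "assoc p n m = - lm p (assoc p q m)"
    by (simp add: assoc_def left_simps left_square_minus_one)
  have sq: "rm (rm (rm m p) q) p = - rm (rm (rm m p) p) q" "rm (rm m n) p = - rm (rm m p) n"
    using right_anticommute[of q p "rm m p"] right_anticommute[of n p m] by simp_all
  \<comment> \<open>With \<open>A = assoc p q\<close>: \<open>A R\<^sub>p = - R\<^sub>p A\<close> while the commutator \<open>A R\<^sub>p - R\<^sub>p A\<close> equals \<open>2 L\<^sub>p A\<close>.\<close>
  have neg: "assoc p q (rm m p) = - rm (assoc p q m) p"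
    by (simp add: assoc_right right_simps sq)
  have "assoc p q (rm m p) - rm (assoc p q m) p
      = lm p (rm (lm q m) p - lm q (rm m p)) - (rm (lm n m) p - lm n (rm m p))"
    by (simp add: assoc_def left_simps right_simps left_right_commute)
  also have "\<dots> = lm p (assoc p q m) - assoc p n m"
    by (simp add: assoc_middle[symmetric])
  finally have "- (2 *\<^sub>R rm (assoc p q m) p) = 2 *\<^sub>R lm p (assoc p q m)"
    by (simp add: neg n scaleR_2)
  then have "2 *\<^sub>R (- rm (assoc p q m) p) = 2 *\<^sub>R lm p (assoc p q m)"
    by simp
  then show ?thesis
    by (metis scaleR_cancel_left minus_minus zero_neq_numeral)
qed

text \<open>The hypothesis puts \<open>w\<close> into the image of \<open>assoc p q\<close>, where
  \<open>assoc_anticommute\<close> applies.\<close>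

lemma right_eq_minus_left:
  assumes t: "quaternion_triple p q n" and w: "lm p (lm q w) = - lm n w"
  shows "rm w p = - lm p w"
proof -
  note [simp] = t[unfolded quaternion_triple_def]
  have "lm p (lm q (lm n w)) = lm n (lm p (lm q w))"
    by (simp add: left_anticommute[of n q] left_anticommute[of n p] left_simps)
  \<comment> \<open>By \<open>w\<close>, \<open>assoc p q w = 2 *\<^sub>R lm n w\<close>. Since
    \<open>lm n\<close> commutes with \<open>assoc p q\<close> on \<open>w\<close> and squares to
    \<open>-1\<close>, a preimage of \<open>w\<close> is \<open>- n w / 2\<close>.\<close>
  then have "assoc p q (lm n ((- 1 / 2) *\<^sub>R w)) = (1 / 2) *\<^sub>R (w + w)"
    by (simp add: assoc_def w left_simps left_square_minus_one scaleR_right_distrib)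
  then have "assoc p q (lm n ((- 1 / 2) *\<^sub>R w)) = w"
    by (simp add: scaleR_half_double)
  then show ?thesis
    using assoc_anticommute[OF t, of "lm n ((- 1 / 2) *\<^sub>R w)"] by simp
qed

text \<open>Multiplication by \<open>r\<close> commutes with the composite of \<open>lm p\<close>
  and \<open>lm q\<close> but anticommutes with \<open>lm n\<close>, so it carries the kernel of
  \<open>assoc p q\<close> into the eigenspace of \<open>right_eq_minus_left\<close>.\<close>

lemma right_eq_minus_left_off_triple:
  assumes t: "quaternion_triple p q n" and z: "assoc p q z = 0"
    and r: "r * p = - (p * r)" "r * q = - (q * r)" "r * n = - (n * r)"
  shows "rm (lm r z) p = - lm p (lm r z)"
proof (rule right_eq_minus_left[OF t])
  have "lm p (lm q (lm r z)) = lm r (lm p (lm q z))"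
    by (simp add: left_anticommute[OF r(1)] left_anticommute[OF r(2)] left_simps)
  also have "\<dots> = lm r (lm n z)"
    using z t by (simp add: assoc_def quaternion_triple_def)
  finally show "lm p (lm q (lm r z)) = - lm n (lm r z)"
    by (simp add: left_anticommute[OF r(3)])
qed

text \<open>The two signs, from passing to \<open>lm r z\<close> and from moving \<open>lm r\<close>
  past \<open>lm p\<close>, cancel; then \<open>lm r\<close> is invertible.\<close>

lemma right_eq_left:
  assumes "quaternion_triple p q n" "assoc p q z = 0" "assoc p r z = 0" "r * r = - 1"
    and r: "r * p = - (p * r)" "r * q = - (q * r)" "r * n = - (n * r)"
  shows "rm z p = lm p z"
proof -
  have "lm r (rm z p) = rm (lm r z) p"
    using assoc_middle[of p r z] assms(3) by simp
  also have "\<dots> = - lm p (lm r z)"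
    using right_eq_minus_left_off_triple assms by blast
  also have "\<dots> = lm r (lm p z)"
    by (simp add: left_anticommute[OF r(1)])
  finally have "lm r (lm r (rm z p)) = lm r (lm r (lm p z))"
    by simp
  then show ?thesis
    by (simp add: left_square_minus_one assms(4))
qed

lemma assoc_eq_0_off_triple:
  assumes "quaternion_triple p q n" "assoc p q z = 0" "rm z p = lm p z"
    and r: "r * p = - (p * r)" "r * q = - (q * r)" "r * n = - (n * r)"
  shows "assoc p r z = 0"
proof -
  have "assoc p r z = rm (lm r z) p - lm r (lm p z)"
    by (simp add: assoc_middle assms(3))
  then show ?thesis
    using right_eq_minus_left_off_triple[OF assms(1,2) r] left_anticommute[OF r(1), of z] by simp
qed

lemma right_eq_left_mult:
  assumes "assoc p q z = 0" "rm z p = lm p z" "rm z q = lm q z"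
  shows "rm z (p * q) = lm (p * q) z"
proof -
  have "rm z (p * q) = rm (lm p z) q"
    using assoc_right[of p q z] assms by simp
  also have "\<dots> = lm p (lm q z)"
    using assoc_middle[of q p z] assoc_swap[of q p z] assms by simp
  finally show ?thesis
    using assms(1) by (simp add: assoc_def)
qed

section \<open>The center and a membership test by three associators\<close>

definition center :: "'m set" where
  "center = {z. (\<forall>p. rm z p = lm p z) \<and> (\<forall>p q. assoc p q z = 0)}"

lemma triple_cyclic_assoc:
  assumes t: "quaternion_triple p q n" and z: "assoc p q z = 0"
  shows "assoc q n z = 0"
proof -
  note [simp] = t[unfolded quaternion_triple_def]
  have "lm n z = lm p (lm q z)"
    using z by (simp add: assoc_def)
  then have "lm q (lm n z) = lm p z"
    by (simp add: left_anticommute[of q p] left_square_minus_one left_simps)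
  then show ?thesis
    by (simp add: assoc_def)
qed

lemma assoc_one [simp]: "assoc p 1 z = 0"
  by (simp add: assoc_def left_one)

lemma assoc_eq_0_if_units:
  assumes "assoc p e1 z = 0" "assoc p e2 z = 0" "assoc p e3 z = 0" "assoc p e4 z = 0"
    "assoc p e5 z = 0" "assoc p e6 z = 0" "assoc p e7 z = 0"
  shows "assoc p q z = 0"
proof -
  have "subspace {q. assoc p q z = 0}"
    by (rule linear_subspace_kernel[OF linear_assoc])
  from octonion_subspace_UNIV[OF this, of q] assms show ?thesis
    by simp
qed

text \<open>The units \<open>e1\<close>, \<open>e2\<close>, \<open>e4\<close> generate the
  octonions. Commutation with them comes first, then with their products; this in turn makes the
  remaining associators vanish, one unit at a time.\<close>

lemma centerI:
  assumes z: "assoc e1 e2 z = 0" "assoc e1 e4 z = 0" "assoc e2 e4 z = 0"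
  shows "z \<in> center"
proof -
  note triples = unit_triples unit_triples[THEN quaternion_triple_cyclic]
    unit_triples[THEN quaternion_triple_cyclic, THEN quaternion_triple_cyclic]
  have cyc: "assoc e2 e3 z = 0" "assoc e4 e5 z = 0" "assoc e4 e6 z = 0"
    "assoc e3 e1 z = 0" "assoc e5 e1 z = 0" "assoc e6 e2 z = 0"
    using triples triple_cyclic_assoc z by blast+
  have swap: "assoc q p z = 0" if "assoc p q z = 0" for p q
    using that assoc_swap[of q p z] by simp
  have c1: "rm z e1 = lm e1 z"
    by (rule right_eq_left[OF triples(1) z(1,2)]) (simp_all add: unit_square unit_anticommute)
  have c2: "rm z e2 = lm e2 z"
    by (rule right_eq_left[OF triples(4) cyc(1) z(3)]) (simp_all add: unit_square unit_anticommute)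
  have c4: "rm z e4 = lm e4 z"
    by (rule right_eq_left[OF triples(5) cyc(2) swap[OF z(3)]])
      (simp_all add: unit_square unit_anticommute)
  have c3: "rm z e3 = lm e3 z" and c5: "rm z e5 = lm e5 z" and c6: "rm z e6 = lm e6 z"
    using right_eq_left_mult[OF z(1) c1 c2] right_eq_left_mult[OF z(2) c1 c4]
      right_eq_left_mult[OF z(3) c2 c4] by (simp_all add: unit_products)
  \<comment> \<open>Each rule treats a unit of a triple against the units outside it. Two triples
    through each of \<open>e1\<close>, \<open>e2\<close>, \<open>e4\<close> cover all their
    partners; antisymmetry fills the gaps for \<open>e3\<close>, \<open>e5\<close>,
    \<open>e6\<close> and gives everything for \<open>e7\<close>, which lies in no triple.\<close>
  note off = assoc_eq_0_off_triple[OF triples(1) z(1) c1] assoc_eq_0_off_triple[OF triples(2) z(2) c1]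
    assoc_eq_0_off_triple[OF triples(4) cyc(1) c2] assoc_eq_0_off_triple[OF triples(3) z(3) c2]
    assoc_eq_0_off_triple[OF triples(5) cyc(2) c4] assoc_eq_0_off_triple[OF triples(6) cyc(3) c4]
    assoc_eq_0_off_triple[OF triples(7) cyc(4) c3] assoc_eq_0_off_triple[OF triples(8) cyc(5) c5]
    assoc_eq_0_off_triple[OF triples(9) cyc(6) c6]
  have a1: "assoc e1 q z = 0" for q
    by (rule assoc_eq_0_if_units) (simp_all add: z off(1,2) unit_anticommute)
  have a2: "assoc e2 q z = 0" for q
    by (rule assoc_eq_0_if_units) (simp_all add: z swap[OF a1] off(3,4) unit_anticommute)
  have a4: "assoc e4 q z = 0" for q
    by (rule assoc_eq_0_if_units)
      (simp_all add: swap[OF a1] swap[OF a2] off(5,6) unit_anticommute)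
  have a3: "assoc e3 q z = 0" for q
    by (rule assoc_eq_0_if_units)
      (simp_all add: swap[OF a1] swap[OF a2] swap[OF a4] off(7) unit_anticommute)
  have a5: "assoc e5 q z = 0" for q
    by (rule assoc_eq_0_if_units)
      (simp_all add: swap[OF a1] swap[OF a2] swap[OF a3] swap[OF a4] off(8) unit_anticommute)
  have a6: "assoc e6 q z = 0" for q
    by (rule assoc_eq_0_if_units)
      (simp_all add: swap[OF a1] swap[OF a2] swap[OF a3] swap[OF a4] swap[OF a5] off(9)
        unit_anticommute)
  have a7: "assoc e7 q z = 0" for q
    by (rule assoc_eq_0_if_units)
      (simp_all add: swap[OF a1] swap[OF a2] swap[OF a3] swap[OF a4] swap[OF a5] swap[OF a6])
  have "assoc p q z = 0" for p q
    by (rule assoc_eq_0_if_units)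
      (simp_all add: swap[OF a1] swap[OF a2] swap[OF a3] swap[OF a4] swap[OF a5] swap[OF a6]
        swap[OF a7])
  moreover have "rm z p = lm p z" for p
  proof -
    have c7: "rm z e7 = lm e7 z"
      using right_eq_left_mult[OF a3[of e4] c3 c4] by (simp add: unit_products)
    have "subspace {p. rm z p = lm p z}"
      by (simp add: subspace_def left_simps right_simps)
    from octonion_subspace_UNIV[OF this, of p] show ?thesis
      by (simp add: c1 c2 c3 c4 c5 c6 c7 left_one right_one)
  qed
  ultimately show ?thesis
    by (simp add: center_def)
qed

section \<open>The projection onto the center\<close>

lemmas clifford =
  unit_square[THEN left_square_minus_one] unit_anticommute[THEN left_anticommute]

text \<open>
  For a quaternion triple, \<open>m \<mapsto> p (q (n m))\<close> is an involution whose \<open>-1\<close>-eigenspace is the kernel of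
  \<open>assoc p q\<close>, so \<open>flip p q n\<close> is twice the projection onto that kernel. The involutions of the
  three triples below commute, and left multiplication by the units permutes their eight joint
  eigenspaces simply transitively.
\<close>

definition flip :: "octonion \<Rightarrow> octonion \<Rightarrow> octonion \<Rightarrow> 'm \<Rightarrow> 'm" where
  "flip p q n m = m - lm p (lm q (lm n m))"

definition re :: "'m \<Rightarrow> 'm" where
  "re m = (1 / 8) *\<^sub>R flip e1 e2 e3 (flip e1 e4 e5 (flip e2 e4 e6 m))"

lemma linear_re: "linear re"
  by (rule linearI) (simp_all add: re_def flip_def left_simps algebra_simps)

text \<open>The three factors of \<open>re\<close> commute, and each maps into one of the kernels
  required by \<open>centerI\<close>.\<close>

lemma re_in_center: "re m \<in> center"
  by (rule centerI)
    (simp_all add: assoc_def unit_products re_def flip_def left_simps clifford algebra_simps)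

text \<open>The inverse of \<open>lm e\<close> is \<open>- lm e\<close>, so the summands are the
  conjugates of \<open>re\<close> by the units: the projections onto the eight joint eigenspaces,
  which add up to the identity.\<close>

lemma re_expand:
  "m = re m - lm e1 (re (lm e1 m)) - lm e2 (re (lm e2 m)) - lm e3 (re (lm e3 m))
     - lm e4 (re (lm e4 m)) - lm e5 (re (lm e5 m)) - lm e6 (re (lm e6 m)) - lm e7 (re (lm e7 m))"
proof -
  have eight: "8 *\<^sub>R m = m + (m + (m + (m + (m + (m + (m + m))))))"
  proof -
    have "8 = 1 + (1 + (1 + (1 + (1 + (1 + (1 + (1 :: real)))))))"
      by simp
    then show ?thesis
      by (simp only: scaleR_left_distrib scaleR_one)
  qed
  have "8 *\<^sub>R m = 8 *\<^sub>R (re m - lm e1 (re (lm e1 m)) - lm e2 (re (lm e2 m)) - lm e3 (re (lm e3 m))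
     - lm e4 (re (lm e4 m)) - lm e5 (re (lm e5 m)) - lm e6 (re (lm e6 m)) - lm e7 (re (lm e7 m)))"
    by (simp add: eight re_def flip_def left_simps clifford algebra_simps)
  then show ?thesis
    by (rule scaleR_left_imp_eq[rotated]) simp
qed

lemma center_left: "z \<in> center \<Longrightarrow> lm p (lm q z) = lm (p * q) z"
  by (simp add: center_def assoc_def)

lemma center_right: "z \<in> center \<Longrightarrow> rm (lm p z) q = lm (p * q) z"
  using assoc_middle[of q p z] by (simp add: center_def center_left)

lemma re_left_center:
  assumes "z \<in> center"
  shows "re (lm x z) = octonion_re x *\<^sub>R z"
proof -
  \<comment> \<open>\<open>g\<close> is \<open>flip\<close> for the regular bimodule, acting on the
    coefficient of \<open>z\<close>.\<close>
  define g where "g p q n y = y - p * (q * (n * y))" for p q n y :: octonion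
  have "flip p q n (lm y z) = lm (g p q n y) z" for p q n y
    using assms by (simp add: flip_def g_def left_simps center_left)
  then have "re (lm x z) = (1 / 8) *\<^sub>R lm (g e1 e2 e3 (g e1 e4 e5 (g e2 e4 e6 x))) z"
    by (simp add: re_def)
  also have "g e1 e2 e3 (g e1 e4 e5 (g e2 e4 e6 x)) = (8 * octonion_re x) *\<^sub>R 1"
    by (simp add: g_def octonion_re_def unit_defs octonion_eq_iff octonion_defs)
  finally show ?thesis
    by (simp add: left_simps left_one)
qed

text \<open>By \<open>re_expand\<close> the octonion multiples of central elements span the
  bimodule.\<close>

lemma linear_eq_on_center_multiples:
  assumes "linear f" "linear g" and eq: "\<And>x z. z \<in> center \<Longrightarrow> f (lm x z) = g (lm x z)"
  shows "f m = g m"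
proof -
  have "f (re m') = g (re m')" for m'
    using eq[OF re_in_center, of 1] by (simp add: left_one)
  then show ?thesis
    by (subst (1 2) re_expand[of m])
      (simp add: linear_diff[OF assms(1)] linear_diff[OF assms(2)] eq re_in_center)
qed

section \<open>Homomorphisms into the octonions\<close>

definition hom :: "('m \<Rightarrow> real) \<Rightarrow> 'm \<Rightarrow> octonion" where
  "hom f m = f (re m) *\<^sub>R 1
     - f (re (lm e1 m)) *\<^sub>R e1 - f (re (lm e2 m)) *\<^sub>R e2 - f (re (lm e3 m)) *\<^sub>R e3
     - f (re (lm e4 m)) *\<^sub>R e4 - f (re (lm e5 m)) *\<^sub>R e5 - f (re (lm e6 m)) *\<^sub>R e6
     - f (re (lm e7 m)) *\<^sub>R e7"

lemma linear_hom:
  assumes "linear f"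
  shows "linear (hom f)"
  by (rule linearI)
    (simp_all add: hom_def left_simps linear_add[OF linear_re] linear_scale[OF linear_re]
      linear_add[OF assms] linear_scale[OF assms] algebra_simps)

text \<open>\<open>hom f\<close> is \<open>octonion_expand\<close> with \<open>f \<circ> re\<close>
  for \<open>octonion_re\<close>; by \<open>re_left_center\<close> its coordinates at
  \<open>lm x z\<close> are those of \<open>x\<close> times \<open>f z\<close>.\<close>

lemma hom_left_center:
  assumes "linear f" "z \<in> center"
  shows "hom f (lm x z) = f z *\<^sub>R x"
  by (subst (2) octonion_expand[of x])
    (simp add: hom_def re_left_center center_left assms linear_scale[OF assms(1)] algebra_simps)

lemma hom_left:
  assumes "linear f"
  shows "hom f (lm p m) = p * hom f m"
proof (rule linear_eq_on_center_multiples)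
  show "linear (\<lambda>m. hom f (lm p m))" "linear (\<lambda>m. p * hom f m)"
    by (rule linearI; simp add: left_simps octonion_bilinear linear_add[OF linear_hom[OF assms]]
        linear_scale[OF linear_hom[OF assms]])+
qed (simp add: center_left hom_left_center assms octonion_bilinear)

lemma hom_right:
  assumes "linear f"
  shows "hom f (rm m p) = hom f m * p"
proof (rule linear_eq_on_center_multiples)
  show "linear (\<lambda>m. hom f (rm m p))" "linear (\<lambda>m. hom f m * p)"
    by (rule linearI; simp add: right_simps octonion_bilinear linear_add[OF linear_hom[OF assms]]
        linear_scale[OF linear_hom[OF assms]])+
qed (simp add: center_right hom_left_center assms octonion_bilinear)

text \<open>Linear functionals separate points, and the coordinates of \<open>hom f m\<close> are,
  up to sign, the values of \<open>f\<close> at the central coefficients of \<open>m\<close> in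
  \<open>re_expand\<close>.\<close>

lemma hom_separates:
  assumes "\<And>f. linear f \<Longrightarrow> hom f m = 0"
  shows "m = 0"
proof -
  have zero: "u = 0" if u: "\<And>f :: 'm \<Rightarrow> real. linear f \<Longrightarrow> f u = 0" for u
  proof (rule ccontr)
    assume "u \<noteq> 0"
    then have "independent {u}"
      by simp
    then obtain f :: "'m \<Rightarrow> real" where "linear f" "f u = 1"
      using linear_independent_extend[of "{u}" "\<lambda>_. 1 :: real"] by auto
    then show False
      using u[of f] by simp
  qed
  have "f (re m) = 0 \<and> f (re (lm e1 m)) = 0 \<and> f (re (lm e2 m)) = 0 \<and> f (re (lm e3 m)) = 0 \<and>
      f (re (lm e4 m)) = 0 \<and> f (re (lm e5 m)) = 0 \<and> f (re (lm e6 m)) = 0 \<and> f (re (lm e7 m)) = 0"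
    if "linear f" for f :: "'m \<Rightarrow> real"
    using assms[OF that] by (simp add: hom_def unit_defs octonion_eq_iff octonion_defs)
  then have "re m = 0 \<and> re (lm e1 m) = 0 \<and> re (lm e2 m) = 0 \<and> re (lm e3 m) = 0 \<and>
      re (lm e4 m) = 0 \<and> re (lm e5 m) = 0 \<and> re (lm e6 m) = 0 \<and> re (lm e7 m) = 0"
    by (intro conjI zero) auto
  then show ?thesis
    by (subst re_expand[of m]) (simp add: left_simps)
qed

lemma hom_injective:
  assumes "\<And>f. linear f \<Longrightarrow> hom f m = hom f n"
  shows "m = n"
  using hom_separates[of "m - n"] assms by (simp add: linear_diff[OF linear_hom])

text \<open>With \<open>y\<close> inverse to one nonzero image of \<open>m\<close>, all images of
  \<open>lm y m\<close> are real. Reals commute and associate, and injectivity of the family of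
  homomorphisms carries this back to \<open>lm y m\<close>.\<close>

lemma center_multiple_if_homs_proportional:
  assumes proportional: "\<And>f g. linear f \<Longrightarrow> linear g \<Longrightarrow> hom f m \<noteq> 0 \<Longrightarrow> \<exists>c. hom g m = c *\<^sub>R hom f m"
  shows "\<exists>x. \<exists>z\<in>center. m = lm x z"
proof (cases "m = 0")
  case True
  then show ?thesis
    using re_in_center by (metis left_simps(7))
next
  case False
  then obtain f where f: "linear f" "hom f m \<noteq> 0"
    using hom_separates by blast
  obtain y where y: "y * hom f m = 1"
    using octonion_division_algebra(2)[OF f(2)] by blast
  have z: "\<exists>c. hom g (lm y m) = c *\<^sub>R 1 \<and> hom g m = c *\<^sub>R hom f m" if "linear g" for g
    using proportional[OF f(1) that f(2)] y by (auto simp: hom_left that octonion_bilinear)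
  have "rm (lm y m) p = lm p (lm y m)" for p
  proof (rule hom_injective)
    fix g :: "'m \<Rightarrow> real" assume g: "linear g"
    with z[OF g] show "hom g (rm (lm y m) p) = hom g (lm p (lm y m))"
      by (auto simp: hom_right hom_left[OF g, of p] octonion_bilinear)
  qed
  moreover have "assoc p q (lm y m) = 0" for p q
  proof (rule hom_separates)
    fix g :: "'m \<Rightarrow> real" assume g: "linear g"
    with z[OF g] show "hom g (assoc p q (lm y m)) = 0"
      by (auto simp: assoc_def linear_diff[OF linear_hom] hom_left[OF g, of p] hom_left[OF g, of q]
          hom_left[OF g, of "p * q"] octonion_bilinear)
  qed
  ultimately have "lm y m \<in> center"
    by (simp add: center_def)
  moreover have "m = lm (hom f m) (lm y m)"
  proof (rule hom_injective)
    fix g :: "'m \<Rightarrow> real" assume g: "linear g"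
    with z[OF g] show "hom g m = hom g (lm (hom f m) (lm y m))"
      by (auto simp: hom_left[OF g, of "hom f m"] octonion_bilinear)
  qed
  ultimately show ?thesis
    by blast
qed

section \<open>Both properties as being a multiple of a central element\<close>

lemma orbits_eq_iff_center_multiple:
  "left_orbit lm m = right_orbit rm m \<longleftrightarrow> (\<exists>x. \<exists>z\<in>center. m = lm x z)"
proof
  assume eq: "left_orbit lm m = right_orbit rm m"
  have "\<exists>q. lm p m = rm m q" for p
    using eq by (auto simp: left_orbit_def right_orbit_def)
  \<comment> \<open>\<open>q\<close> is found in the bimodule before any functional is chosen, so it
    serves \<open>f\<close> and \<open>g\<close> at once.\<close>
  then have "\<exists>q. p * hom f m = hom f m * q \<and> p * hom g m = hom g m * q"
    if "linear f" "linear g" for f g p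
    using that by (metis hom_left hom_right)
  then show "\<exists>x. \<exists>z\<in>center. m = lm x z"
    by (intro center_multiple_if_homs_proportional octonion_multiple_if_orbits_agree)
next
  assume "\<exists>x. \<exists>z\<in>center. m = lm x z"
  then obtain x z where m: "m = lm x z" and z: "z \<in> center"
    by blast
  show "left_orbit lm m = right_orbit rm m"
  proof (cases "x = 0")
    case True
    then show ?thesis
      by (simp add: m left_orbit_def right_orbit_def left_simps right_simps)
  next
    case False
    \<comment> \<open>The orbits are \<open>(O x) z\<close> and \<open>(x O) z\<close>, and by
      division both coefficient sets are all of \<open>O\<close>.\<close>
    have "\<exists>q. p * x = x * q" "\<exists>q. x * p = q * x" for p
      using octonion_division_algebra[OF False] by metis+
    then show ?thesis
      unfolding m left_orbit_def right_orbit_def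
      by (auto simp: center_left[OF z] center_right[OF z]) metis+
  qed
qed

text \<open>The orbit is a linear image of the octonions containing \<open>m\<close>, so only its
  closure under left multiplication is in question.\<close>

lemma cyclic_iff_orbit_closed:
  "cyclic_element lm m \<longleftrightarrow> (\<forall>p q. \<exists>r. lm p (lm q m) = lm r m)"
proof
  assume cyc: "cyclic_element lm m"
  have "left_octonion_submodule lm (generated_left_submodule lm m)"
    unfolding generated_left_submodule_def
    by (rule hull_in) (auto simp: left_octonion_submodule_def intro: subspace_Inter)
  then show "\<forall>p q. \<exists>r. lm p (lm q m) = lm r m"
    using cyc by (simp add: cyclic_element_def left_octonion_submodule_def left_orbit_def) blast
next
  assume closed: "\<forall>p q. \<exists>r. lm p (lm q m) = lm r m"
  have orbit: "left_orbit lm m = range (\<lambda>p. lm p m)"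
    by (auto simp: left_orbit_def)
  have "linear (\<lambda>p. lm p m)"
    using bilinear_left by (simp add: bilinear_def)
  then have "subspace (left_orbit lm m)"
    unfolding orbit by (rule linear_subspace_image) simp
  then have sub: "left_octonion_submodule lm (left_orbit lm m)"
    using closed by (auto simp: left_octonion_submodule_def left_orbit_def)
  have "lm 1 m \<in> left_orbit lm m"
    unfolding left_orbit_def by blast
  then have "m \<in> left_orbit lm m"
    by (simp add: left_one)
  then show "cyclic_element lm m"
    unfolding cyclic_element_def generated_left_submodule_def
    by (intro hull_unique sub) (auto simp: left_octonion_submodule_def left_orbit_def)
qed

lemma cyclic_iff_center_multiple:
  "cyclic_element lm m \<longleftrightarrow> (\<exists>x. \<exists>z\<in>center. m = lm x z)"
  unfolding cyclic_iff_orbit_closed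
proof
  assume closed: "\<forall>p q. \<exists>r. lm p (lm q m) = lm r m"
  have "\<exists>r. p * (q * hom f m) = r * hom f m \<and> p * (q * hom g m) = r * hom g m"
    if "linear f" "linear g" for f g p q
    using that closed by (metis hom_left)
  then show "\<exists>x. \<exists>z\<in>center. m = lm x z"
    by (intro center_multiple_if_homs_proportional octonion_multiple_if_orbit_closed)
next
  assume "\<exists>x. \<exists>z\<in>center. m = lm x z"
  then obtain x z where m: "m = lm x z" and z: "z \<in> center"
    by blast
  show "\<forall>p q. \<exists>r. lm p (lm q m) = lm r m"
  proof (cases "x = 0")
    case True
    then show ?thesis
      by (simp add: m left_simps)
  next
    case False
    \<comment> \<open>All factors act on the coefficient of \<open>z\<close>, where right division
      by \<open>x\<close> yields \<open>r\<close>.\<close>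
    then have "\<exists>r. p * (q * x) = r * x" for p q
      using octonion_division_algebra(2)[OF False] by metis
    then show ?thesis
      unfolding m center_left[OF z] by metis
  qed
qed

end

theorem corollary5p12:
  fixes lm :: "octonion \<Rightarrow> 'm::real_vector \<Rightarrow> 'm"
    and rm :: "'m \<Rightarrow> octonion \<Rightarrow> 'm"
    and m :: 'm
  assumes "octonion_bimodule lm rm"
  shows "left_orbit lm m = right_orbit rm m \<longleftrightarrow> cyclic_element lm m"
proof -
  interpret octonion_bimodule lm rm
    by (rule assms)
  show ?thesis
    unfolding orbits_eq_iff_center_multiple cyclic_iff_center_multiple ..
qed

end
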